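(* Let $K$ be a non-trivial field and let $A$ be a 2-dimensional endo-commutative straight algebra of rank 1 over $K$. Then: (i) $A$ is non-unital. (ii) $A$ is commutative if and only if $A\cong S(0,0,0,0,0,0)$, $A\cong S(0,0,0,1,0,1)$ or $A\cong S(0,1,0,1,0,1)$. (iii) If $\operatorname{char}K\neq 2$, then $A$ is not anti-commutative. (iv) $A$ is associative if and only if $A\cong S(0,0,0,0,0,0)$ or $A\cong S(0,1,0,1,0,1)$.
   Context: A non-trivial field is a field other than $\mathbb F_2$, the field of two elements. An algebra over $K$ is a $K$-vector space with a bilinear multiplication, not assumed associative, commutative or unital; isomorphism ($\cong$) means $K$-algebra isomorphism. An algebra $A$ is endo-commutative if $x^2y^2=(xy)^2$ for all $x,y\in A$; it is anti-commutative if $xy+yx=0$ for all $x,y\in A$; it is unital if it has a (two-sided) identity element. A 2-dimensional algebra $A$ is curled if $x^2$ is a scalar multiple of $x$ for every $x\in A$; otherwise it is straight (equivalently, there is $x\in A$ such that $x$ and $x^2$ are linearly independent). For a 2-dimensional algebra with linear base $\{e,f\}$, write $e^2=a_1e+b_1f$, $f^2=a_2e+b_2f$, $ef=a_3e+b_3f$, $fe=a_4e+b_4f$; the $4\times 2$ matrix over $K$ with rows $(a_1,b_1),(a_2,b_2),(a_3,b_3),(a_4,b_4)$ is the structure matrix of $A$ with respect to $\{e,f\}$. The rank of $A$ is the rank of its structure matrix with respect to a linear base (it does not depend on the base). For $p,q,a,b,c,d\in K$, $S(p,q,a,b,c,d)$ denotes the 2-dimensional algebra over $K$ with linear base $\{e,f\}$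 and multiplication $e^2=f$, $f^2=pe+qf$, $ef=ae+bf$, $fe=ce+df$. *)

theory Defs
  imports "HOL-Analysis.Analysis"
begin

section \<open>Two-dimensional nonassociative algebras\<close>

locale nonassoc_algebra = vector_space scale
  for scale :: "'k::field \<Rightarrow> 'v::ab_group_add \<Rightarrow> 'v" +
  fixes mult :: "'v \<Rightarrow> 'v \<Rightarrow> 'v"
  assumes linear_mult_right: "Vector_Spaces.linear scale scale (\<lambda>y. mult x y)"
    and linear_mult_left: "Vector_Spaces.linear scale scale (\<lambda>x. mult x y)"

locale two_dim_algebra = nonassoc_algebra scale mult
  for scale :: "'k::field \<Rightarrow> 'v::ab_group_add \<Rightarrow> 'v" and mult +
  assumes dim_UNIV: "dim UNIV = 2"

definition algebra_isomorphic ::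
  "('k::field \<Rightarrow> 'v::ab_group_add \<Rightarrow> 'v) \<Rightarrow> ('v \<Rightarrow> 'v \<Rightarrow> 'v) \<Rightarrow>
   ('k \<Rightarrow> 'w::ab_group_add \<Rightarrow> 'w) \<Rightarrow> ('w \<Rightarrow> 'w \<Rightarrow> 'w) \<Rightarrow> bool" where
  "algebra_isomorphic s m s' m' \<longleftrightarrow>
     (\<exists>\<phi>. Vector_Spaces.linear s s' \<phi> \<and> bij \<phi> \<and> (\<forall>x y. \<phi> (m x y) = m' (\<phi> x) (\<phi> y)))"

definition commutative_mult :: "('v \<Rightarrow> 'v \<Rightarrow> 'v) \<Rightarrow> bool" where
  "commutative_mult m \<longleftrightarrow> (\<forall>x y. m x y = m y x)"

definition anti_commutative_mult :: "('v::ab_group_add \<Rightarrow> 'v \<Rightarrow> 'v) \<Rightarrow> bool" where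
  "anti_commutative_mult m \<longleftrightarrow> (\<forall>x y. m x y + m y x = 0)"

definition associative_mult :: "('v \<Rightarrow> 'v \<Rightarrow> 'v) \<Rightarrow> bool" where
  "associative_mult m \<longleftrightarrow> (\<forall>x y z. m (m x y) z = m x (m y z))"

definition unital_mult :: "('v \<Rightarrow> 'v \<Rightarrow> 'v) \<Rightarrow> bool" where
  "unital_mult m \<longleftrightarrow> (\<exists>u. \<forall>x. m u x = x \<and> m x u = x)"

definition endo_commutative :: "('v \<Rightarrow> 'v \<Rightarrow> 'v) \<Rightarrow> bool" where
  "endo_commutative m \<longleftrightarrow> (\<forall>x y. m (m x x) (m y y) = m (m x y) (m x y))"

definition curled :: "('k \<Rightarrow> 'v \<Rightarrow> 'v) \<Rightarrow> ('v \<Rightarrow> 'v \<Rightarrow> 'v) \<Rightarrow> bool" where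
  "curled s m \<longleftrightarrow> (\<forall>x. \<exists>c. m x x = s c x)"

definition straight :: "('k \<Rightarrow> 'v \<Rightarrow> 'v) \<Rightarrow> ('v \<Rightarrow> 'v \<Rightarrow> 'v) \<Rightarrow> bool" where
  "straight s m \<longleftrightarrow> \<not> curled s m"


section \<open>Structure matrix and rank\<close>

definition linear_base ::
  "('k::field \<Rightarrow> 'v::ab_group_add \<Rightarrow> 'v) \<Rightarrow> 'v \<Rightarrow> 'v \<Rightarrow> bool" where
  "linear_base s e f \<longleftrightarrow>
     e \<noteq> f \<and> \<not> module.dependent s {e, f} \<and> module.span s {e, f} = UNIV"

definition coords ::
  "('k::field \<Rightarrow> 'v::ab_group_add \<Rightarrow> 'v) \<Rightarrow> 'v \<Rightarrow> 'v \<Rightarrow> 'v \<Rightarrow> 'k^2" where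
  "coords s e f v =
     vector [module.representation s {e, f} v e, module.representation s {e, f} v f]"

definition structure_matrix ::
  "('k::field \<Rightarrow> 'v::ab_group_add \<Rightarrow> 'v) \<Rightarrow> ('v \<Rightarrow> 'v \<Rightarrow> 'v) \<Rightarrow> 'v \<Rightarrow> 'v \<Rightarrow> 'k^2^4" where
  "structure_matrix s m e f =
     vector [coords s e f (m e e), coords s e f (m f f), coords s e f (m e f), coords s e f (m f e)]"

text \<open>The choice of the base is immaterial, see \<open>algebra_rank_eq\<close> below.\<close>

definition algebra_rank ::
  "('k::field \<Rightarrow> 'v::ab_group_add \<Rightarrow> 'v) \<Rightarrow> ('v \<Rightarrow> 'v \<Rightarrow> 'v) \<Rightarrow> nat" where
  "algebra_rank s m =
     (case (SOME (e, f). linear_base s e f) of (e, f) \<Rightarrow> rank (structure_matrix s m e f))"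

lemma (in two_dim_algebra) linear_base_exists: "\<exists>e f. linear_base scale e f"
proof -
  obtain B where B: "independent B" "span B = UNIV"
    using basis_exists[of UNIV] span_UNIV by (metis top.extremum_uniqueI)
  have "card B = 2"
    using dim_eq_card[of B UNIV] B dim_UNIV by simp
  then obtain e f where "B = {e, f}" "e \<noteq> f" by (auto simp: card_2_iff)
  with B show ?thesis unfolding linear_base_def by blast
qed

lemma (in vector_space) coords_inj_linear:
  assumes "linear_base scale e f"
  shows "Vector_Spaces.linear scale (*s) (coords scale e f)" "inj (coords scale e f)"
proof -
  have ind: "independent {e, f}" and sp: "span {e, f} = UNIV" and ne: "e \<noteq> f"
    using assms by (auto simp: linear_base_def)
  show "Vector_Spaces.linear scale (*s) (coords scale e f)"
    by unfold_locales
      (use ind sp in \<open>auto simp: coords_def vec_eq_iff forall_2 representation_add representation_scale\<close>)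
  show "inj (coords scale e f)"
  proof (rule injI)
    fix v w
    assume eq: "coords scale e f v = coords scale e f w"
    have *: "u = scale (coords scale e f u $ 1) e + scale (coords scale e f u $ 2) f" for u
      using sum_representation_eq[OF ind, of u "{e, f}"] sp ne by (simp add: coords_def)
    show "v = w" using *[of v] *[of w] eq by metis
  qed
qed

lemma (in nonassoc_algebra) span_products:
  assumes "linear_base scale e f"
  shows "span {mult e e, mult f f, mult e f, mult f e} = span (range (\<lambda>(x, y). mult x y))"
    (is "span ?P = span ?Q")
proof (rule antisym)
  show "span ?P \<subseteq> span ?Q"
    by (rule span_mono) auto
  have rep: "\<exists>a b. x = scale a e + scale b f" for x
  proof -
    have "x \<in> span {e, f}" using assms by (simp add: linear_base_def)
    then obtain a where "x - scale a e \<in> span {f}" by (auto simp: span_insert)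
    then obtain b where "x - scale a e = scale b f" by (auto simp: span_singleton)
    then have "x = scale a e + scale b f" by (simp add: algebra_simps)
    then show ?thesis by blast
  qed
  have "mult x y \<in> span ?P" for x y
  proof -
    interpret R: Vector_Spaces.linear scale scale "\<lambda>v. mult u v" for u
      by (rule linear_mult_right)
    interpret L: Vector_Spaces.linear scale scale "\<lambda>v. mult v u" for u
      by (rule linear_mult_left)
    obtain a b where x: "x = scale a e + scale b f" using rep by blast
    obtain c d where y: "y = scale c e + scale d f" using rep by blast
    have eq: "mult x y = scale c (scale a (mult e e) + scale b (mult f e)) +
        scale d (scale a (mult e f) + scale b (mult f f))"
      by (simp only: x y L.add L.scale R.add R.scale)
    show ?thesis
      unfolding eq by (intro span_add span_scale) (simp_all add: span_base)
  qed
  then have "?Q \<subseteq> span ?P" by auto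
  then show "span ?Q \<subseteq> span ?P"
    by (simp add: span_minimal)
qed

lemma (in two_dim_algebra) rank_structure_matrix:
  assumes "linear_base scale e f"
  shows "rank (structure_matrix scale mult e f) = dim (range (\<lambda>(x, y). mult x y))"
proof -
  let ?P = "{mult e e, mult f f, mult e f, mult f e}"
  have pair: "finite_dimensional_vector_space_pair_1 scale {e, f} ((*s) :: 'k \<Rightarrow> 'k^2 \<Rightarrow> 'k^2)"
    unfolding finite_dimensional_vector_space_pair_1_def finite_dimensional_vector_space_def
      finite_dimensional_vector_space_axioms_def
    using assms vector_space_axioms vec.vector_space_axioms by (simp add: linear_base_def)
  have v4: "vector [p, q, r, t] $ (1 :: 4) = p" "vector [p, q, r, t] $ (2 :: 4) = q"
    "vector [p, q, r, t] $ (3 :: 4) = r" "vector [p, q, r, t] $ (4 :: 4) = t"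
    for p q r t :: "'k^2"
    by (simp_all add: vector_def)
  have "rows (structure_matrix scale mult e f) = range (\<lambda>i. structure_matrix scale mult e f $ i)"
    by (auto simp: rows_def row_def vec_lambda_eta)
  also have "\<dots> = coords scale e f ` ?P"
    by (simp only: UNIV_4 structure_matrix_def v4 image_insert image_empty)
  finally have "rank (structure_matrix scale mult e f) = vec.dim (coords scale e f ` ?P)"
    by (simp add: row_rank_def_gen)
  also have "\<dots> = dim ?P"
    by (rule finite_dimensional_vector_space_pair_1.dim_image_eq[OF pair coords_inj_linear(1)[OF assms]
          inj_on_subset[OF coords_inj_linear(2)[OF assms] subset_UNIV]])
  also have "\<dots> = dim (range (\<lambda>(x, y). mult x y))"
    by (subst (1 2) dim_span[symmetric]) (simp only: span_products[OF assms])
  finally show ?thesis .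
qed

lemma (in two_dim_algebra) algebra_rank_eq:
  assumes "linear_base scale e f"
  shows "algebra_rank scale mult = rank (structure_matrix scale mult e f)"
proof -
  obtain e' f' where c: "(SOME (e, f). linear_base scale e f) = (e', f')"
    by (metis surj_pair)
  have "case (SOME (e, f). linear_base scale e f) of (e, f) \<Rightarrow> linear_base scale e f"
    by (rule someI_ex) (use assms in auto)
  with c have "linear_base scale e' f'" by simp
  with c assms show ?thesis by (simp add: algebra_rank_def rank_structure_matrix)
qed


section \<open>The algebras S(p,q,a,b,c,d)\<close>

text \<open>The underlying space is \<open>'k^2\<close> with its standard base as \<open>e, f\<close>.\<close>

definition S_e :: "'k::field^2" where "S_e = axis 1 1"
definition S_f :: "'k::field^2" where "S_f = axis 2 1"

definition S_mult ::
  "'k::field \<Rightarrow> 'k \<Rightarrow> 'k \<Rightarrow> 'k \<Rightarrow> 'k \<Rightarrow> 'k \<Rightarrow> 'k^2 \<Rightarrow> 'k^2 \<Rightarrow> 'k^2" where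
  "S_mult p q a b c d x y =
     (x$1 * y$1) *s S_f + (x$2 * y$2) *s (p *s S_e + q *s S_f)
     + (x$1 * y$2) *s (a *s S_e + b *s S_f) + (x$2 * y$1) *s (c *s S_e + d *s S_f)"

lemma S_mult_base:
  "S_mult p q a b c d S_e S_e = S_f"
  "S_mult p q a b c d S_f S_f = p *s S_e + q *s S_f"
  "S_mult p q a b c d S_e S_f = a *s S_e + b *s S_f"
  "S_mult p q a b c d S_f S_e = c *s S_e + d *s S_f"
  by (auto simp: S_mult_def S_e_def S_f_def axis_def vec_eq_iff forall_2)

lemma linear_base_S: "linear_base (*s) (S_e :: 'k::field^2) S_f"
proof -
  have "cart_basis = {S_e :: 'k^2, S_f}"
    by (auto simp: cart_basis_def S_e_def S_f_def UNIV_2)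
  moreover have "(S_e :: 'k^2) \<noteq> S_f"
    by (simp add: S_e_def S_f_def axis_eq_axis)
  ultimately show ?thesis
    using vec.independent_Basis vec.span_Basis by (simp add: linear_base_def)
qed

lemma two_dim_algebra_S: "two_dim_algebra (*s) (S_mult p q a b c (d :: 'k::field))"
proof
  show "vec.dim (UNIV :: ('k^2) set) = 2"
    by (simp add: card_cart_basis vec.dimension_def)
qed (auto simp: S_mult_def vec_eq_iff forall_2 S_e_def S_f_def axis_def algebra_simps)

abbreviation isomorphic_to_S ::
  "('k::field \<Rightarrow> 'v::ab_group_add \<Rightarrow> 'v) \<Rightarrow> ('v \<Rightarrow> 'v \<Rightarrow> 'v) \<Rightarrow>
   'k \<Rightarrow> 'k \<Rightarrow> 'k \<Rightarrow> 'k \<Rightarrow> 'k \<Rightarrow> 'k \<Rightarrow> bool" where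
  "isomorphic_to_S s m p q a b c d \<equiv> algebra_isomorphic s m (*s) (S_mult p q a b c d)"

end

theory Submission
  imports Defs
begin

text \<open>
  In a rank 1 algebra all products lie on one line. If \<open>e\<close> and \<open>f = e\<^sup>2\<close> are independent, that
  line is spanned by \<open>f\<close>, so the multiplication is \<open>x y = B x y f\<close> for a bilinear form \<open>B\<close> with
  \<open>B e e = 1\<close>. It is thus described by the three scalars \<open>q = B f f\<close>, \<open>b = B e f\<close>, \<open>d = B f e\<close>,
  and the algebra is \<open>S(0,q,0,b,0,d)\<close>.

  Endo-commutativity says \<open>q B(x,x) B(y,y) = q B(x,y)\<^sup>2\<close>. Either \<open>q = 0\<close> and nothing
  more is required, or \<open>q = b\<^sup>2 = d\<^sup>2 \<noteq> 0\<close>, and then testing at \<open>x = e + f\<close>, \<open>y = e\<close> gives \<open>b = d\<close>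
  (lemma \<open>endo_commutative_parameters\<close>). In the second case \<open>B\<close> is the square of a linear form.

  Commutativity means \<open>b = d\<close>. Replacing \<open>e\<close> by \<open>r e\<close> turns \<open>(q,b,d)\<close> into
  \<open>(r\<^sup>2 q, r b, r d)\<close>, so \<open>r = 1/b\<close> normalises a non-zero \<open>b\<close> to \<open>1\<close>; this leaves the triples
  \<open>(0,0,0)\<close>, \<open>(0,1,1)\<close> and \<open>(1,1,1)\<close>. Associativity of \<open>e e e\<close> forces \<open>b = d\<close>, and
  associativity of \<open>e e f\<close> forces \<open>q = b\<^sup>2\<close>, which excludes exactly \<open>(0,1,1)\<close>. An identity
  element cannot exist because the products do not fill the plane, and anti-commutativity
  would give \<open>2 f = e\<^sup>2 + e\<^sup>2 = 0\<close>.
\<close>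

section \<open>Bases and isomorphisms\<close>

context nonassoc_algebra
begin

lemma mult_bilinear:
  "mult (x + y) z = mult x z + mult y z" "mult x (y + z) = mult x y + mult x z"
  "mult (scale r x) y = scale r (mult x y)" "mult x (scale r y) = scale r (mult x y)"
proof -
  interpret R: Vector_Spaces.linear scale scale "\<lambda>v. mult u v" for u
    by (rule linear_mult_right)
  interpret L: Vector_Spaces.linear scale scale "\<lambda>v. mult v u" for u
    by (rule linear_mult_left)
  show "mult (x + y) z = mult x z + mult y z" "mult x (y + z) = mult x y + mult x z"
    "mult (scale r x) y = scale r (mult x y)" "mult x (scale r y) = scale r (mult x y)"
    by (simp_all only: L.add R.add L.scale R.scale)
qed

end

context vector_space
begin

lemma coords_expansion:
  assumes "linear_base scale e f"
  shows "v = scale (coords scale e f v $ 1) e + scale (coords scale e f v $ 2) f"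
  using assms sum_representation_eq[of "{e, f}" v "{e, f}"]
  by (simp add: linear_base_def coords_def)

lemma coords_base:
  assumes "linear_base scale e f"
  shows "coords scale e f e = S_e" "coords scale e f f = S_f"
  using assms representation_basis[of "{e, f}" e] representation_basis[of "{e, f}" f]
  by (auto simp: linear_base_def coords_def vec_eq_iff forall_2 S_e_def S_f_def axis_def)

end

lemma (in nonassoc_algebra) isomorphic_to_S_if_table:
  assumes base: "linear_base scale e f"
    and ee: "mult e e = f" and ff: "mult f f = scale p e + scale q f"
    and ef: "mult e f = scale a e + scale b f" and fe: "mult f e = scale c e + scale d f"
  shows "isomorphic_to_S scale mult p q a b c d"
proof -
  let ?\<phi> = "coords scale e f"
  interpret \<phi>: Vector_Spaces.linear scale "(*s)" ?\<phi>
    by (rule coords_inj_linear(1)[OF base])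
  note hom = \<phi>.add \<phi>.scale coords_base[OF base]
  have "?\<phi> (scale (v $ 1) e + scale (v $ 2) f) = v" for v
    by (simp add: hom) (simp add: vec_eq_iff forall_2 S_e_def S_f_def axis_def)
  then have "surj ?\<phi>"
    by (rule surjI)
  then have "bij ?\<phi>"
    using coords_inj_linear(2)[OF base] by (simp add: bij_def)
  moreover have "?\<phi> (mult x y) = S_mult p q a b c d (?\<phi> x) (?\<phi> y)" for x y
  proof -
    let ?x = "?\<phi> x" and ?y = "?\<phi> y"
    have "mult x y = mult (scale (?x $ 1) e + scale (?x $ 2) f)
        (scale (?y $ 1) e + scale (?y $ 2) f)"
      using coords_expansion[OF base] by metis
    also have "\<dots> = scale (?x $ 1) (scale (?y $ 1) f)
        + scale (?x $ 2) (scale (?y $ 2) (scale p e + scale q f))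
        + scale (?x $ 1) (scale (?y $ 2) (scale a e + scale b f))
        + scale (?x $ 2) (scale (?y $ 1) (scale c e + scale d f))"
      by (simp add: mult_bilinear ee ff ef fe scale_right_distrib mult_ac add_ac)
    finally show ?thesis
      by (simp only: hom S_mult_def) (simp add: vec_eq_iff)
  qed
  ultimately show ?thesis
    unfolding algebra_isomorphic_def using \<phi>.linear_axioms by blast
qed

lemma commutative_if_isomorphic:
  assumes "algebra_isomorphic s m s' m'" and "commutative_mult m'"
  shows "commutative_mult m"
  using assms unfolding algebra_isomorphic_def commutative_mult_def
  by (metis bij_is_inj injD)

lemma associative_if_isomorphic:
  assumes "algebra_isomorphic s m s' m'" and "associative_mult m'"
  shows "associative_mult m"
  using assms unfolding algebra_isomorphic_def associative_mult_def
  by (metis bij_is_inj injD)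

lemma commutative_S: "commutative_mult (S_mult p q a b a b)"
  by (simp add: commutative_mult_def S_mult_def vec_eq_iff algebra_simps)

lemma associative_S_null: "associative_mult (S_mult 0 0 0 0 0 0)"
  by (simp add: associative_mult_def S_mult_def vec_eq_iff S_f_def axis_def)

text \<open>
  Here \<open>x y = l(x) l(y) f\<close> for the linear form \<open>l\<close> taking the value \<open>1\<close> at \<open>e\<close> and at \<open>f\<close>,
  so that both bracketings of \<open>x y z\<close> are \<open>l(x) l(y) l(z) f\<close>.
\<close>

lemma associative_S_idempotent: "associative_mult (S_mult 0 1 0 1 0 1)"
proof -
  have "S_mult 0 1 0 1 0 1 x y = ((x $ 1 + x $ 2) * (y $ 1 + y $ 2)) *s S_f" for x y :: "'a^2"
    by (simp add: S_mult_def vec_eq_iff algebra_simps)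
  then show ?thesis
    by (simp add: associative_mult_def S_f_def axis_def mult.assoc)
qed

section \<open>Straight algebras of rank 1\<close>

locale square_line_algebra = two_dim_algebra scale mult
  for scale :: "'k::field \<Rightarrow> 'v::ab_group_add \<Rightarrow> 'v" and mult +
  fixes e f :: 'v and q b d :: 'k
  assumes base: "linear_base scale e f"
    and ee: "mult e e = f"
    and ff: "mult f f = scale q f"
    and ef: "mult e f = scale b f"
    and fe: "mult f e = scale d f"

text \<open>
  The line of products contains \<open>f = e\<^sup>2 \<noteq> 0\<close> and therefore consists of the multiples of \<open>f\<close>.
\<close>

lemma (in two_dim_algebra) straight_rank_1_obtains:
  assumes "straight scale mult" and "algebra_rank scale mult = 1"
  obtains e f q b d where "square_line_algebra scale mult e f q b d"
proof -
  obtain e where e: "\<And>c. mult e e \<noteq> scale c e"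
    using assms(1) by (auto simp: straight_def curled_def)
  define f where "f = mult e e"
  have "e \<noteq> 0"
    using e[of 0] mult_bilinear(3)[of 0 0 0] by auto
  have "f \<notin> span {e}"
    using e by (auto simp: f_def span_singleton)
  then have ne: "f \<noteq> e" and ind: "independent {f, e}"
    using \<open>e \<noteq> 0\<close> by (auto simp: independent_insert span_base)
  obtain e0 f0 where base0: "linear_base scale e0 f0"
    using linear_base_exists by blast
  interpret fin: finite_dimensional_vector_space scale "{e0, f0}"
    by unfold_locales (use base0 in \<open>auto simp: linear_base_def\<close>)
  have "UNIV \<subseteq> span {f, e}"
    by (rule fin.card_ge_dim_independent) (use ind ne dim_UNIV in auto)
  then have base: "linear_base scale e f"
    using ind ne by (auto simp: linear_base_def insert_commute)
  let ?P = "range (\<lambda>(x, y). mult x y)"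
  have "dim ?P = 1"
    using assms(2) algebra_rank_eq[OF base] rank_structure_matrix[OF base] by simp
  moreover have "{f} \<subseteq> ?P"
    by (auto simp: f_def intro: range_eqI[where x = "(e, e)"])
  moreover have "independent {f}"
    using ind independent_mono by blast
  ultimately have "?P \<subseteq> span {f}"
    by (intro fin.card_ge_dim_independent) auto
  then have "\<exists>c. mult x y = scale c f" for x y
    by (auto simp: span_singleton)
  then obtain q b d where "mult f f = scale q f" "mult e f = scale b f" "mult f e = scale d f"
    by metis
  then have "square_line_algebra scale mult e f q b d"
    by unfold_locales (use base in \<open>simp_all add: f_def\<close>)
  then show thesis by (rule that)
qed

context square_line_algebra
begin

lemma f_nonzero: "f \<noteq> 0"
  using base dependent_zero[of "{e, f}"] by (auto simp: linear_base_def)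

lemma isomorphic_to_S_rescaled:
  assumes "r \<noteq> 0"
  shows "isomorphic_to_S scale mult 0 (r\<^sup>2 * q) 0 (r * b) 0 (r * d)"
proof (rule isomorphic_to_S_if_table)
  let ?e = "scale r e" and ?f = "scale (r\<^sup>2) f"
  have e_multiple: "e = scale (inverse r) ?e" and f_multiple: "f = scale (inverse (r\<^sup>2)) ?f"
    using assms by simp_all
  obtain "e \<noteq> f" "f \<noteq> 0" and e_notin: "e \<notin> span {f}"
    using base f_nonzero by (auto simp: linear_base_def independent_insert)
  have "?e \<notin> span {?f}"
  proof
    assume "?e \<in> span {?f}"
    then have "?e \<in> span {f}" by (auto simp: span_singleton)
    then show False using e_notin e_multiple span_scale by metis
  qed
  moreover have "?f \<noteq> 0" using \<open>f \<noteq> 0\<close> assms by simp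
  ultimately have "?e \<noteq> ?f" "independent {?e, ?f}"
    by (auto simp: independent_insert span_base)
  moreover have "span {?e, ?f} = UNIV"
  proof -
    have "e \<in> span {?e, ?f}" "f \<in> span {?e, ?f}"
      by (subst e_multiple, rule span_scale, simp add: span_base)
        (subst f_multiple, rule span_scale, simp add: span_base)
    then have "span {e, f} \<subseteq> span {?e, ?f}"
      by (simp add: span_minimal)
    then show ?thesis
      using base by (auto simp: linear_base_def)
  qed
  ultimately show "linear_base scale ?e ?f"
    by (simp add: linear_base_def)
  show "mult ?e ?e = ?f" "mult ?f ?f = scale 0 ?e + scale (r\<^sup>2 * q) ?f"
    "mult ?e ?f = scale 0 ?e + scale (r * b) ?f" "mult ?f ?e = scale 0 ?e + scale (r * d) ?f"
    by (simp_all add: mult_bilinear ee ff ef fe power2_eq_square mult_ac)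
qed

lemma isomorphic_to_S_null:
  assumes "q = 0" "b = 0" "d = 0"
  shows "isomorphic_to_S scale mult 0 0 0 0 0 0"
  using isomorphic_to_S_rescaled[of 1] assms by simp

lemma isomorphic_to_S_normalised:
  assumes "b \<noteq> 0" "d = b"
  shows "isomorphic_to_S scale mult 0 (q / b\<^sup>2) 0 1 0 1"
  using isomorphic_to_S_rescaled[of "inverse b"] assms by (simp add: field_simps)

lemma commutative_parameters:
  assumes "commutative_mult mult"
  shows "b = d"
  using assms f_nonzero unfolding commutative_mult_def by (metis ef fe scale_cancel_right)

lemma associative_parameters:
  assumes "associative_mult mult"
  shows "b = d" and "q = b\<^sup>2"
proof -
  have assoc: "mult (mult x y) z = mult x (mult y z)" for x y z
    using assms by (simp add: associative_mult_def)
  show "b = d"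
    using assoc[of e e e] f_nonzero by (simp add: ee ef fe)
  show "q = b\<^sup>2"
    using assoc[of e e f] f_nonzero by (simp add: ee ff ef mult_bilinear power2_eq_square)
qed

lemma endo_commutative_parameters:
  assumes "endo_commutative mult" and "q \<noteq> 0"
  shows "b = d" and "q = b\<^sup>2"
proof -
  have endo: "mult (mult x x) (mult y y) = mult (mult x y) (mult x y)" for x y
    using assms(1) unfolding endo_commutative_def by blast
  show q: "q = b\<^sup>2"
    using endo[of e f] f_nonzero assms(2)
    by (simp add: ee ff ef mult_bilinear power2_eq_square mult.assoc)
  have q': "q = d\<^sup>2"
    using endo[of f e] f_nonzero assms(2)
    by (simp add: ee ff fe mult_bilinear power2_eq_square mult.assoc)
  \<comment> \<open>The squares of \<open>b\<close> and \<open>d\<close> leave the sign of \<open>d\<close> open; the cross term \<open>b + d\<close> of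
    \<open>(e + f)\<^sup>2\<close> decides it.\<close>
  have sq: "mult (e + f) (e + f) = scale (1 + b + d + q) f"
    by (simp add: mult_bilinear ee ff ef fe scale_left_distrib)
  have prod: "mult (e + f) e = scale (1 + d) f"
    by (simp add: mult_bilinear ee fe scale_left_distrib)
  have "(1 + b + d + q) * q = (1 + d) * ((1 + d) * q)"
    using endo[of "e + f" e] f_nonzero unfolding sq prod ee
    by (simp add: ff mult_bilinear)
  then have "1 + b + d + q = (1 + d) * (1 + d)"
    using assms(2) by simp
  then show "b = d"
    unfolding q' by (simp add: algebra_simps power2_eq_square)
qed

lemma products_on_line: "mult x y \<in> span {f}"
proof -
  have "range (\<lambda>(x, y). mult x y) \<subseteq> span (range (\<lambda>(x, y). mult x y))"
    by (rule span_superset)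
  also have "\<dots> = span {f, scale q f, scale b f, scale d f}"
    using span_products[OF base] by (simp only: ee ff ef fe)
  also have "\<dots> \<subseteq> span {f}"
    by (rule span_minimal) (auto simp: span_scale span_base)
  finally show ?thesis by auto
qed

lemma not_unital: "\<not> unital_mult mult"
proof
  assume "unital_mult mult"
  then obtain u where "mult u e = e"
    by (auto simp: unital_mult_def)
  then have "e \<in> span {f}"
    using products_on_line by metis
  then show False
    using base by (auto simp: linear_base_def independent_insert)
qed

lemma not_anti_commutative:
  assumes "CHAR('k) \<noteq> 2"
  shows "\<not> anti_commutative_mult mult"
proof
  assume "anti_commutative_mult mult"
  then have "mult e e + mult e e = 0"
    by (simp add: anti_commutative_mult_def)
  then have "scale (1 + 1) f = 0"
    unfolding ee by (simp only: scale_left_distrib scale_one)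
  then have "of_nat 2 = (0 :: 'k)"
    using f_nonzero by simp
  then have "CHAR('k) dvd 2"
    by (simp only: of_nat_eq_0_iff_char_dvd)
  then have "CHAR('k) = 1"
    using assms two_is_prime_nat prime_nat_iff by blast
  then show False
    using of_nat_CHAR[where 'a = 'k] by simp
qed

end

theorem corollary2:
  fixes scale :: "'k::field \<Rightarrow> 'v::ab_group_add \<Rightarrow> 'v"
    and mult :: "'v \<Rightarrow> 'v \<Rightarrow> 'v"
  assumes nontrivial_field: "CARD('k) \<noteq> 2"
    and algebra: "two_dim_algebra scale mult"
    and endo_commutative: "endo_commutative mult"
    and straight: "straight scale mult"
    and rank_1: "algebra_rank scale mult = 1"
  shows "\<not> unital_mult mult \<and>
    (commutative_mult mult \<longleftrightarrow>
       isomorphic_to_S scale mult 0 0 0 0 0 0 \<or>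
       isomorphic_to_S scale mult 0 0 0 1 0 1 \<or>
       isomorphic_to_S scale mult 0 1 0 1 0 1) \<and>
    (CHAR('k) \<noteq> 2 \<longrightarrow> \<not> anti_commutative_mult mult) \<and>
    (associative_mult mult \<longleftrightarrow>
       isomorphic_to_S scale mult 0 0 0 0 0 0 \<or>
       isomorphic_to_S scale mult 0 1 0 1 0 1)"
proof -
  obtain e f q b d where "square_line_algebra scale mult e f q b d"
    using two_dim_algebra.straight_rank_1_obtains[OF algebra straight rank_1] .
  then interpret square_line_algebra scale mult e f q b d .
  have idempotent: "isomorphic_to_S scale mult 0 1 0 1 0 1" if "b \<noteq> 0" "d = b" "q = b\<^sup>2"
    using isomorphic_to_S_normalised that by simp
  have comm: "commutative_mult mult \<longleftrightarrow>
       isomorphic_to_S scale mult 0 0 0 0 0 0 \<or>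
       isomorphic_to_S scale mult 0 0 0 1 0 1 \<or>
       isomorphic_to_S scale mult 0 1 0 1 0 1" (is "_ \<longleftrightarrow> ?S")
  proof
    assume "commutative_mult mult"
    then have d: "d = b"
      by (simp add: commutative_parameters)
    consider "q = 0" "b = 0" | "q = 0" "b \<noteq> 0" | "b \<noteq> 0" "q = b\<^sup>2"
      using endo_commutative_parameters[OF endo_commutative] by fastforce
    then show ?S
    proof cases
      case 1
      then show ?thesis using isomorphic_to_S_null d by simp
    next
      case 2
      then show ?thesis using isomorphic_to_S_normalised d by simp
    next
      case 3
      then show ?thesis using idempotent d by simp
    qed
  next
    assume ?S
    then show "commutative_mult mult"
      using commutative_if_isomorphic commutative_S by blast
  qed
  have assoc: "associative_mult mult \<longleftrightarrow>
       isomorphic_to_S scale mult 0 0 0 0 0 0 \<or>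
       isomorphic_to_S scale mult 0 1 0 1 0 1" (is "_ \<longleftrightarrow> ?S")
  proof
    assume "associative_mult mult"
    then have "d = b" "q = b\<^sup>2"
      by (simp_all add: associative_parameters)
    then show ?S
      using isomorphic_to_S_null idempotent by (cases "b = 0") simp_all
  next
    assume ?S
    then show "associative_mult mult"
      using associative_if_isomorphic associative_S_null associative_S_idempotent by blast
  qed
  show ?thesis
    using not_unital comm not_anti_commutative assoc by blast
qed

end
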